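(* Let $S\in\mathcal{IC}$ be an idempotent covered semigroup. Then $S$ is finite (respectively periodic, regular) if and only if the semiband $T(S)$ is finite (respectively periodic, regular).
   Context: For a semigroup $S$, $E(S)$ denotes its set of idempotents, and $S^1$ denotes $S$ itself if $S$ is a monoid, and otherwise $S$ with an identity $1$ adjoined. $S$ is idempotent covered ($S\in\mathcal{IC}$) if for every $s\in S$ there are $e,f\in E(S)$ with $se=s=fs$. A semiband is a semigroup generated by its idempotents. A semigroup is periodic if each of its monogenic (one-generated) subsemigroups is finite. Let $R_2=\{\sigma,\tau\}$ be the two-element right-zero semigroup, and let $T*R_2$ be the set $S\times S\times R_2$ with product $(t_1,s_1,\sigma)(t_2,s_2,\alpha_2)=(t_1s_2,\,s_1s_2,\,\alpha_2)$ and $(t_1,s_1,\tau)(t_2,s_2,\alpha_2)=(t_1t_2,\,s_1t_2,\,\alpha_2)$ (a semidirect product of $T=S\times S$ by $R_2$). Let $E=\{(s,t,\alpha)\in E(T*R_2):\ s\in S^1t\}$ and $T(S)=\langle E\rangle$, the subsemigroup generated by $E$; for $S\in\mathcal{IC}$ one has $T(S)=\{(s,t,\alpha)\in T*R_2: s\in S^1t\}$. *)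

theory Defs
  imports Main
begin

text \<open>
  Semigroups are given by a carrier and an operation, so that a semigroup \<open>S\<close> and its
  companion \<open>T(S)\<close>, which need not be all of \<open>S \<times> S \<times> R\<^sub>2\<close>, are treated alike.
  Values of the operation outside the carrier are irrelevant.
\<close>

locale semigroup_on =
  fixes S :: "'a set" and mul :: "'a \<Rightarrow> 'a \<Rightarrow> 'a"
  assumes closed: "x \<in> S \<Longrightarrow> y \<in> S \<Longrightarrow> mul x y \<in> S"
    and assoc: "x \<in> S \<Longrightarrow> y \<in> S \<Longrightarrow> z \<in> S \<Longrightarrow> mul (mul x y) z = mul x (mul y z)"

definition idempotents :: "'a set \<Rightarrow> ('a \<Rightarrow> 'a \<Rightarrow> 'a) \<Rightarrow> 'a set" where
  "idempotents S mul = {e \<in> S. mul e e = e}"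

definition idempotent_covered :: "'a set \<Rightarrow> ('a \<Rightarrow> 'a \<Rightarrow> 'a) \<Rightarrow> bool" where
  "idempotent_covered S mul \<longleftrightarrow>
     (\<forall>s\<in>S. \<exists>e\<in>idempotents S mul. \<exists>f\<in>idempotents S mul. mul s e = s \<and> mul f s = s)"

inductive_set generated :: "('a \<Rightarrow> 'a \<Rightarrow> 'a) \<Rightarrow> 'a set \<Rightarrow> 'a set"
  for mul :: "'a \<Rightarrow> 'a \<Rightarrow> 'a" and A :: "'a set" where
  incl: "a \<in> A \<Longrightarrow> a \<in> generated mul A"
| mult: "a \<in> generated mul A \<Longrightarrow> b \<in> generated mul A \<Longrightarrow> mul a b \<in> generated mul A"

definition semiband :: "'a set \<Rightarrow> ('a \<Rightarrow> 'a \<Rightarrow> 'a) \<Rightarrow> bool" where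
  "semiband S mul \<longleftrightarrow> semigroup_on S mul \<and> S = generated mul (idempotents S mul)"

definition periodic :: "'a set \<Rightarrow> ('a \<Rightarrow> 'a \<Rightarrow> 'a) \<Rightarrow> bool" where
  "periodic S mul \<longleftrightarrow> (\<forall>a\<in>S. finite (generated mul {a}))"

definition regular :: "'a set \<Rightarrow> ('a \<Rightarrow> 'a \<Rightarrow> 'a) \<Rightarrow> bool" where
  "regular S mul \<longleftrightarrow> (\<forall>a\<in>S. \<exists>x\<in>S. mul (mul a x) a = a)"

text \<open>
  The semigroup \<open>S\<^sup>1\<close>: the elements of \<open>S\<close> are tagged with \<^const>\<open>Some\<close>, and
  \<^const>\<open>None\<close> is the adjoined identity, present only if \<open>S\<close> has no identity of its own.
\<close>

definition has_identity :: "'a set \<Rightarrow> ('a \<Rightarrow> 'a \<Rightarrow> 'a) \<Rightarrow> bool" where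
  "has_identity S mul \<longleftrightarrow> (\<exists>e\<in>S. \<forall>x\<in>S. mul e x = x \<and> mul x e = x)"

definition S1_carrier :: "'a set \<Rightarrow> ('a \<Rightarrow> 'a \<Rightarrow> 'a) \<Rightarrow> 'a option set" where
  "S1_carrier S mul = (if has_identity S mul then Some ` S else insert None (Some ` S))"

fun S1_mult :: "('a \<Rightarrow> 'a \<Rightarrow> 'a) \<Rightarrow> 'a option \<Rightarrow> 'a option \<Rightarrow> 'a option" where
  "S1_mult mul None y = y"
| "S1_mult mul (Some x) None = Some x"
| "S1_mult mul (Some x) (Some y) = Some (mul x y)"

text \<open>The subset \<open>S\<^sup>1t\<close> of \<open>S\<close>.\<close>

definition left_ideal1 :: "'a set \<Rightarrow> ('a \<Rightarrow> 'a \<Rightarrow> 'a) \<Rightarrow> 'a \<Rightarrow> 'a set" where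
  "left_ideal1 S mul t = {s. \<exists>u\<in>S1_carrier S mul. Some s = S1_mult mul u (Some t)}"

text \<open>
  The semidirect product \<open>T * R\<^sub>2\<close>. The right-zero multiplication of \<open>R\<^sub>2\<close> is visible in
  the last component of \<open>sd_mult\<close>.
\<close>

datatype R2 = R_sigma | R_tau

definition sd_carrier :: "'a set \<Rightarrow> ('a \<times> 'a \<times> R2) set" where
  "sd_carrier S = S \<times> S \<times> UNIV"

fun sd_mult :: "('a \<Rightarrow> 'a \<Rightarrow> 'a) \<Rightarrow> 'a \<times> 'a \<times> R2 \<Rightarrow> 'a \<times> 'a \<times> R2 \<Rightarrow> 'a \<times> 'a \<times> R2" where
  "sd_mult mul (t1, s1, R_sigma) (t2, s2, \<alpha>2) = (mul t1 s2, mul s1 s2, \<alpha>2)"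
| "sd_mult mul (t1, s1, R_tau) (t2, s2, \<alpha>2) = (mul t1 t2, mul s1 t2, \<alpha>2)"

definition T_gens :: "'a set \<Rightarrow> ('a \<Rightarrow> 'a \<Rightarrow> 'a) \<Rightarrow> ('a \<times> 'a \<times> R2) set" where
  "T_gens S mul =
     {(s, t, \<alpha>). (s, t, \<alpha>) \<in> idempotents (sd_carrier S) (sd_mult mul) \<and> s \<in> left_ideal1 S mul t}"

definition T_of :: "'a set \<Rightarrow> ('a \<Rightarrow> 'a \<Rightarrow> 'a) \<Rightarrow> ('a \<times> 'a \<times> R2) set" where
  "T_of S mul = generated (sd_mult mul) (T_gens S mul)"

lemma semigroup_on_sd:
  assumes "semigroup_on S mul"
  shows "semigroup_on (sd_carrier S) (sd_mult mul)"
proof -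
  interpret semigroup_on S mul by fact
  show ?thesis
  proof
    fix x y z :: "'a \<times> 'a \<times> R2"
    obtain t1 s1 a1 where x: "x = (t1, s1, a1)" by (cases x)
    obtain t2 s2 a2 where y: "y = (t2, s2, a2)" by (cases y)
    obtain t3 s3 a3 where z: "z = (t3, s3, a3)" by (cases z)
    show "sd_mult mul x y \<in> sd_carrier S" if "x \<in> sd_carrier S" "y \<in> sd_carrier S"
      using that unfolding x y sd_carrier_def by (cases a1) (auto intro: closed)
    show "sd_mult mul (sd_mult mul x y) z = sd_mult mul x (sd_mult mul y z)"
      if "x \<in> sd_carrier S" "y \<in> sd_carrier S" "z \<in> sd_carrier S"
      using that unfolding x y z sd_carrier_def
      by (cases a1; cases a2) (auto simp: assoc)
  qed
qed

lemma semiband_T_of: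
  assumes "semigroup_on S mul"
  shows "semiband (T_of S mul) (sd_mult mul)"
proof -
  interpret sd: semigroup_on "sd_carrier S" "sd_mult mul"
    by (rule semigroup_on_sd) fact
  have gens: "T_gens S mul \<subseteq> idempotents (sd_carrier S) (sd_mult mul)"
    by (auto simp: T_gens_def)
  have sub: "x \<in> sd_carrier S" if "x \<in> T_of S mul" for x
    using that unfolding T_of_def
  proof (induction rule: generated.induct)
    case (incl a)
    then show ?case using gens by (auto simp: idempotents_def)
  next
    case (mult a b)
    then show ?case by (blast intro: sd.closed)
  qed
  have sg: "semigroup_on (T_of S mul) (sd_mult mul)"
  proof
    show "sd_mult mul x y \<in> T_of S mul" if "x \<in> T_of S mul" "y \<in> T_of S mul" for x y
      using that unfolding T_of_def by (rule generated.mult)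
    show "sd_mult mul (sd_mult mul x y) z = sd_mult mul x (sd_mult mul y z)"
      if "x \<in> T_of S mul" "y \<in> T_of S mul" "z \<in> T_of S mul" for x y z
      using that by (blast intro: sd.assoc sub)
  qed
  let ?I = "idempotents (T_of S mul) (sd_mult mul)"
  have I: "T_gens S mul \<subseteq> ?I"
    using gens unfolding T_of_def idempotents_def by (auto intro: generated.incl)
  have "x \<in> generated (sd_mult mul) ?I" if "x \<in> generated (sd_mult mul) (T_gens S mul)" for x
    using that
  proof (induction rule: generated.induct)
    case (incl a)
    then show ?case using I by (blast intro: generated.incl)
  next
    case (mult a b)
    then show ?case by (blast intro: generated.mult)
  qed
  moreover have "x \<in> T_of S mul" if "x \<in> generated (sd_mult mul) ?I" for x
    using that
    by (induction rule: generated.induct)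
      (auto simp: idempotents_def intro: semigroup_on.closed[OF sg])
  ultimately show ?thesis
    using sg unfolding semiband_def T_of_def by blast
qed

end

theory Submission
  imports Defs
begin

text \<open>
  Everything rests on the explicit description \<open>T(S) = {(ut, t, \<alpha>) | u, t \<in> S}\<close>, valid when
  \<open>S\<close> is idempotent covered (\<open>T_of_eq\<close>). In particular \<open>T(S)\<close> lies inside \<open>S \<times> S \<times> R\<^sub>2\<close> and
  contains the diagonal copy \<open>t \<mapsto> (t, t, \<sigma>)\<close> of \<open>S\<close>, which is a homomorphic embedding. Each
  property passes from \<open>T(S)\<close> down to \<open>S\<close> through this diagonal.

  Conversely, \<open>T(S)\<close> is finite when \<open>S\<close> is. The powers of \<open>(a, b, \<sigma>)\<close> are
  \<open>(ab\<^sup>n, b\<^sup>n\<^sup>+\<^sup>1, \<sigma>)\<close>, with \<open>a\<close> and \<open>b\<close> exchanging roles for \<open>\<tau>\<close>, so there are finitely many of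
  them if \<open>S\<close> is periodic. And if \<open>byb = b\<close> then \<open>(y, y, \<sigma>)\<close> is an inner inverse of
  \<open>(ub, b, \<alpha>)\<close>: multiplying by it on the right gives \<open>(uby, by, \<sigma>)\<close>, and the second factor
  \<open>(ub, b, \<alpha>)\<close> then acts through \<open>b\<close> alone, giving \<open>(ubyb, byb, \<alpha>) = (ub, b, \<alpha>)\<close>.
\<close>

lemma sd_mult_diagonal: "sd_mult mul (a, b, \<alpha>) (y, y, \<beta>) = (mul a y, mul b y, \<beta>)"
  by (cases \<alpha>) auto

context semigroup_on
begin

lemma generated_subset:
  assumes "A \<subseteq> S"
  shows "generated mul A \<subseteq> S"
proof
  fix x assume "x \<in> generated mul A"
  then show "x \<in> S"
    using assms by (induction rule: generated.induct) (auto intro: closed)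
qed

text \<open>
  A left identity \<open>f\<close> of \<open>t\<close> gives \<open>t = ft \<in> St\<close>, so adjoining an identity adds nothing to the
  principal left ideal.
\<close>

lemma left_ideal1_eq:
  assumes "idempotent_covered S mul" "t \<in> S"
  shows "left_ideal1 S mul t = {mul u t | u. u \<in> S}"
proof -
  obtain f where "f \<in> S" "mul f t = t"
    using assms unfolding idempotent_covered_def idempotents_def by blast
  then show ?thesis
    unfolding left_ideal1_def S1_carrier_def by (auto split: if_splits; metis)
qed

lemma sd_idempotent_sigma_iff:
  "(s, t, R_sigma) \<in> idempotents (sd_carrier S) (sd_mult mul) \<longleftrightarrow>
     s \<in> S \<and> t \<in> S \<and> mul s t = s \<and> mul t t = t"
  by (auto simp: idempotents_def sd_carrier_def)

text \<open>
  For the inclusion from right to left, let \<open>ft = t = te\<close> with \<open>e\<close>, \<open>f\<close> idempotent. The generators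
  \<open>(f, f, \<tau>)\<close>, \<open>(t, e, \<sigma>)\<close> and \<open>(e, e, \<alpha>)\<close> have product \<open>(t, t, \<alpha>)\<close>: the factor
  \<open>(f, f, \<tau>)\<close> is needed to make the arbitrary first component of \<open>(t, e, \<sigma>)\<close> act on both
  coordinates. Multiplying \<open>(t, t, \<alpha>)\<close> on the left by the generator \<open>(uf, f, \<sigma>)\<close> gives
  \<open>(uft, ft, \<alpha>) = (ut, t, \<alpha>)\<close>.
\<close>

lemma T_of_eq:
  assumes ic: "idempotent_covered S mul"
  shows "T_of S mul = {(mul u t, t, \<alpha>) | u t \<alpha>. u \<in> S \<and> t \<in> S}"
proof (intro equalityI subsetI)
  fix x assume "x \<in> T_of S mul"
  then show "x \<in> {(mul u t, t, \<alpha>) | u t \<alpha>. u \<in> S \<and> t \<in> S}"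
    unfolding T_of_def
  proof (induction rule: generated.induct)
    case (incl x)
    then obtain s t \<alpha> where x: "x = (s, t, \<alpha>)" and t: "t \<in> S" and "s \<in> left_ideal1 S mul t"
      by (auto simp: T_gens_def idempotents_def sd_carrier_def)
    then obtain u where "u \<in> S" "s = mul u t"
      using left_ideal1_eq[OF ic t] by auto
    then show ?case using x t by blast
  next
    case (mult x y)
    then obtain u s \<alpha> v t \<beta> where x: "x = (mul u s, s, \<alpha>)" and y: "y = (mul v t, t, \<beta>)"
      and S: "u \<in> S" "s \<in> S" "v \<in> S" "t \<in> S"
      by blast
    define c where "c = (case \<alpha> of R_sigma \<Rightarrow> t | R_tau \<Rightarrow> mul v t)"
    have "c \<in> S" using S by (auto simp: c_def closed split: R2.split)
    moreover have "sd_mult mul x y = (mul (mul u s) c, mul s c, \<beta>)"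
      by (cases \<alpha>) (auto simp: x y c_def)
    ultimately show ?case using S by (auto simp: assoc closed)
  qed
next
  fix x :: "'a \<times> 'a \<times> R2"
  assume "x \<in> {(mul u t, t, \<alpha>) | u t \<alpha>. u \<in> S \<and> t \<in> S}"
  then obtain u t \<alpha> where x: "x = (mul u t, t, \<alpha>)" and u: "u \<in> S" and t: "t \<in> S"
    by blast
  obtain e f where e: "e \<in> S" "mul e e = e" "mul t e = t"
    and f: "f \<in> S" "mul f f = f" "mul f t = t"
    using ic t unfolding idempotent_covered_def idempotents_def by blast
  have sigma: "(s, g, R_sigma) \<in> T_gens S mul"
    if "s \<in> S" "g \<in> S" "mul g g = g" "mul s g = s" for s g
    using that sd_idempotent_sigma_iff left_ideal1_eq[OF ic, of g]
    by (auto simp: T_gens_def intro!: exI[of _ s])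
  have diag: "(g, g, \<beta>) \<in> T_gens S mul" if "g \<in> S" "mul g g = g" for g \<beta>
    using that left_ideal1_eq[OF ic, of g]
    by (auto simp: T_gens_def idempotents_def sd_carrier_def sd_mult_diagonal intro!: exI[of _ g])
  have "(f, f, R_tau) \<in> T_gens S mul" "(t, e, R_sigma) \<in> T_gens S mul" "(e, e, \<alpha>) \<in> T_gens S mul"
    using e f t by (auto intro: sigma diag)
  then have "sd_mult mul (sd_mult mul (f, f, R_tau) (t, e, R_sigma)) (e, e, \<alpha>) \<in> T_of S mul"
    unfolding T_of_def by (intro generated.mult generated.incl)
  then have "(t, t, \<alpha>) \<in> T_of S mul"
    using e f by simp
  moreover have "(mul u f, f, R_sigma) \<in> T_of S mul"
    unfolding T_of_def using u f by (intro generated.incl sigma) (auto simp: closed assoc)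
  ultimately have "sd_mult mul (mul u f, f, R_sigma) (t, t, \<alpha>) \<in> T_of S mul"
    unfolding T_of_def by (intro generated.mult)
  then show "x \<in> T_of S mul"
    using u t f by (simp add: x assoc)
qed

lemma diagonal_in_T_of:
  assumes "idempotent_covered S mul" "t \<in> S"
  shows "(t, t, \<alpha>) \<in> T_of S mul"
proof -
  obtain f where "f \<in> S" "mul f t = t"
    using assms unfolding idempotent_covered_def idempotents_def by blast
  then show ?thesis
    using assms(2) unfolding T_of_eq[OF assms(1)]
    by (intro CollectI exI[of _ f] exI[of _ t] exI[of _ \<alpha>]) simp
qed

lemma T_of_subset:
  assumes "idempotent_covered S mul"
  shows "T_of S mul \<subseteq> sd_carrier S"
  by (auto simp: T_of_eq[OF assms] sd_carrier_def closed)

lemma finite_T_of_iff: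
  assumes ic: "idempotent_covered S mul"
  shows "finite (T_of S mul) \<longleftrightarrow> finite S"
proof
  assume "finite (T_of S mul)"
  moreover have "S \<subseteq> fst ` T_of S mul"
    using diagonal_in_T_of[OF ic] by force
  ultimately show "finite S" by (rule finite_surj)
next
  have "(UNIV :: R2 set) = {R_sigma, R_tau}"
    by (auto intro: R2.exhaust)
  then have "finite (UNIV :: R2 set)"
    by (metis finite.emptyI finite_insert)
  moreover assume "finite S"
  ultimately show "finite (T_of S mul)"
    using T_of_subset[OF ic] by (auto simp: sd_carrier_def intro: finite_subset)
qed

text \<open>
  The active coordinate (\<open>b\<close> for \<open>\<sigma>\<close>, \<open>a\<close> for \<open>\<tau>\<close>) runs through its own powers, while the other
  one is multiplied on the right by such powers.
\<close>

lemma generated_sd_subset: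
  assumes S: "a \<in> S" "b \<in> S"
  shows "generated (sd_mult mul) {(a, b, R_sigma)}
      \<subseteq> insert a (mul a ` generated mul {b}) \<times> generated mul {b} \<times> {R_sigma}" (is ?sigma)
    and "generated (sd_mult mul) {(a, b, R_tau)}
      \<subseteq> generated mul {a} \<times> insert b (mul b ` generated mul {a}) \<times> {R_tau}" (is ?tau)
proof -
  have absorb: "mul x y \<in> mul c ` generated mul {d}"
    if prems: "x \<in> insert c (mul c ` generated mul {d})" "y \<in> generated mul {d}" "c \<in> S" "d \<in> S"
    for x y c d
  proof (cases "x = c")
    case True
    then show ?thesis using prems by blast
  next
    case False
    then obtain z where z: "z \<in> generated mul {d}" "x = mul c z"
      using prems(1) by blast
    then have "mul x y = mul c (mul z y)"
      using prems generated_subset[of "{d}"] by (simp add: assoc subset_iff)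
    then show ?thesis using z prems by (auto intro: generated.mult)
  qed
  show ?sigma
  proof
    fix x assume "x \<in> generated (sd_mult mul) {(a, b, R_sigma)}"
    then show "x \<in> insert a (mul a ` generated mul {b}) \<times> generated mul {b} \<times> {R_sigma}"
    proof (induction rule: generated.induct)
      case (incl x)
      then show ?case by (auto intro: generated.incl)
    next
      case (mult x y)
      then show ?case
        using absorb[of _ a b] S by (cases x; cases y) (auto intro: generated.mult)
    qed
  qed
  show ?tau
  proof
    fix x assume "x \<in> generated (sd_mult mul) {(a, b, R_tau)}"
    then show "x \<in> generated mul {a} \<times> insert b (mul b ` generated mul {a}) \<times> {R_tau}"
    proof (induction rule: generated.induct)
      case (incl x)
      then show ?case by (auto intro: generated.incl)
    next
      case (mult x y)
      then show ?case
        using absorb[of _ b a] S by (cases x; cases y) (auto intro: generated.mult)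
    qed
  qed
qed

lemma periodic_T_of_iff:
  assumes ic: "idempotent_covered S mul"
  shows "periodic (T_of S mul) (sd_mult mul) \<longleftrightarrow> periodic S mul"
proof
  assume T: "periodic (T_of S mul) (sd_mult mul)"
  show "periodic S mul"
    unfolding periodic_def
  proof
    fix a assume "a \<in> S"
    then have "finite (generated (sd_mult mul) {(a, a, R_sigma)})"
      using T diagonal_in_T_of[OF ic] unfolding periodic_def by blast
    moreover have "(x, x, R_sigma) \<in> generated (sd_mult mul) {(a, a, R_sigma)}"
      if "x \<in> generated mul {a}" for x
      using that
    proof (induction rule: generated.induct)
      case (incl x)
      then show ?case by (auto intro: generated.incl)
    next
      case (mult x y)
      then show ?case using generated.mult[OF mult.IH] by simp
    qed
    then have "generated mul {a} \<subseteq> fst ` generated (sd_mult mul) {(a, a, R_sigma)}"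
      by force
    ultimately show "finite (generated mul {a})" by (rule finite_surj)
  qed
next
  assume per: "periodic S mul"
  show "periodic (T_of S mul) (sd_mult mul)"
    unfolding periodic_def
  proof
    fix x assume "x \<in> T_of S mul"
    then obtain a b \<alpha> where x: "x = (a, b, \<alpha>)" and S: "a \<in> S" "b \<in> S"
      using T_of_subset[OF ic] by (auto simp: sd_carrier_def)
    have "finite (generated mul {a})" "finite (generated mul {b})"
      using per S by (auto simp: periodic_def)
    then show "finite (generated (sd_mult mul) {x})"
      using generated_sd_subset[OF S] unfolding x
      by (cases \<alpha>) (auto elim!: finite_subset)
  qed
qed

lemma regular_T_of_iff:
  assumes ic: "idempotent_covered S mul"
  shows "regular (T_of S mul) (sd_mult mul) \<longleftrightarrow> regular S mul"
proof
  assume T: "regular (T_of S mul) (sd_mult mul)"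
  show "regular S mul"
    unfolding regular_def
  proof
    fix t assume "t \<in> S"
    then obtain z where "z \<in> T_of S mul"
      and inv: "sd_mult mul (sd_mult mul (t, t, R_sigma) z) (t, t, R_sigma) = (t, t, R_sigma)"
      using T diagonal_in_T_of[OF ic] unfolding regular_def by blast
    then obtain x y \<beta> where z: "z = (x, y, \<beta>)" and "y \<in> S"
      using T_of_subset[OF ic] by (auto simp: sd_carrier_def)
    moreover have "mul (mul t y) t = t"
      using inv by (simp add: z sd_mult_diagonal)
    ultimately show "\<exists>y\<in>S. mul (mul t y) t = t" by blast
  qed
next
  assume reg: "regular S mul"
  show "regular (T_of S mul) (sd_mult mul)"
    unfolding regular_def
  proof
    fix x assume "x \<in> T_of S mul"
    then obtain u b \<alpha> where x: "x = (mul u b, b, \<alpha>)" and S: "u \<in> S" "b \<in> S"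
      unfolding T_of_eq[OF ic] by blast
    obtain y where y: "y \<in> S" "mul (mul b y) b = b"
      using reg S unfolding regular_def by blast
    then have "mul (mul (mul u b) y) b = mul u b"
      using S by (simp add: assoc closed)
    then have "sd_mult mul (sd_mult mul x (y, y, R_sigma)) x = x"
      using y by (simp add: x sd_mult_diagonal)
    then show "\<exists>z\<in>T_of S mul. sd_mult mul (sd_mult mul x z) x = x"
      using diagonal_in_T_of[OF ic y(1)] by blast
  qed
qed

end

theorem proposition4p1:
  fixes S :: "'a set" and mul :: "'a \<Rightarrow> 'a \<Rightarrow> 'a"
  assumes "semigroup_on S mul"
    and "idempotent_covered S mul"
  shows "(finite S \<longleftrightarrow> finite (T_of S mul))
    \<and> (periodic S mul \<longleftrightarrow> periodic (T_of S mul) (sd_mult mul))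
    \<and> (regular S mul \<longleftrightarrow> regular (T_of S mul) (sd_mult mul))"
proof -
  interpret semigroup_on S mul by fact
  show ?thesis
    using finite_T_of_iff periodic_T_of_iff regular_T_of_iff assms(2) by blast
qed

end
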